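(* Let $\alpha\in(0,1)$. Suppose that the data points $(X_i,Y_i)$, $i\in[n+m]$, are exchangeable conditional on the training data $\mathcal D^{\mathrm{tr}}$, and that both the informative set constructor $\mathcal C^{\mathcal I}$ and the trust score function $T$ are permutation-invariant with respect to $\{Z_i\}_{i=1}^{n+m}$. Then the SCIP procedure run at level $\alpha$ satisfies $\mathrm{FCR}\le\alpha$.
   Context: Write $[k]=\{1,\dots,k\}$. Let $n,m\ge1$. Let $Z_i=(X_i,Y_i)\in\mathcal X\times\mathcal Y$, $i\in[n+m]$, be random pairs; the first $n$ are calibration data, the last $m$ are test data (whose responses are unobserved). $\mathcal I$ is a given collection of subsets of $\mathcal Y$ (the informative sets). $\mathbb D$ denotes auxiliary data (e.g. training data $\mathcal D^{\mathrm{tr}}$ or additional calibration data). Permutation invariance. A mapping $G(\cdot)=G(\cdot\,;Z_1,\dots,Z_{n+m},\mathbb D)$ is permutation-invariant with respect to $\{Z_i\}_{i=1}^{n+m}$ if (a) for any fixed $\mathbb D$ and any permutation $\varsigma$ of $[n+m]$, $G(\cdot\,;Z_1,\dots,Z_{n+m},\mathbb D)=G(\cdot\,;Z_{\varsigma(1)},\dots,Z_{\varsigma(n+m)},\mathbb D)$; and (b) if $Z_1,\dots,Z_{n+m}$ are exchangeable, they remain exchangeable conditional on $\mathbb D$. An informative set constructor is a mapping $\mathcal C^{\mathcal I}:\mathcal X\to\mathcal I$, and a trust score is a mapping $T:\mathcal X\times\mathcal I\to(0,\infty)$; both may be indexed by $(Z_1,\dots,Z_{n+m},\mathbb D)$.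 Permutation invariance of the trust score refers to the mapping $x\mapsto T(x,\mathcal C^{\mathcal I}(x))$. Write $\mathcal C_i^{\mathcal I}=\mathcal C^{\mathcal I}(X_i)$ and $T_i=T(X_i,\mathcal C^{\mathcal I}(X_i))$ for $i\in[n+m]$. Generalized conformal $p$-values. For $j\in[m]$, $$p_j^{\mathrm{GC}}=\frac{\sum_{i=1}^n\mathbb I(Y_i\notin\mathcal C_i^{\mathcal I},\,T_i>T_{n+j})+\{1+\sum_{i=1}^n\mathbb I(Y_i\notin\mathcal C_i^{\mathcal I},\,T_i=T_{n+j})\}\,U_j}{n+1},$$ where $U_1,\dots,U_m$ are i.i.d. $\mathrm{Unif}(0,1)$, independent of everything else. SCIP procedure at level $\alpha$: put $\widehat\alpha=\max\{a\in[0,1]:\frac{\alpha}{m}\sum_{j=1}^m\mathbb I(p_j^{\mathrm{GC}}\le a)\ge a\}$ and $\mathcal S=\{j\in[m]:p_j^{\mathrm{GC}}\le\widehat\alpha\}$, and report $\{\mathcal C_{n+j}^{\mathcal I}:j\in\mathcal S\}$. The false coverage rate is $\mathrm{FCR}=\mathbb E\Big[\frac{\sum_{j\in\mathcal S}\mathbb I(Y_{n+j}\notin\mathcal C_{n+j}^{\mathcal I})}{\max(1,|\mathcal S|)}\Big]$. *)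

theory Defs
  imports "HOL-Probability.Probability" "HOL-Combinatorics.Permutations"
begin

text \<open>
  The calligraphic X and Y are the carriers \<open>space MX\<close>, \<open>space MY\<close> of two measurable spaces. A data
  set is an element of \<open>data_space N S\<close> with \<open>S = MX \<Otimes>\<^sub>M MY\<close>, that is, an extensional function on
  \<open>{1..N}\<close>. For a permutation \<open>\<sigma>\<close> of \<open>{1..N}\<close>, the permuted data set is \<open>z \<circ> \<sigma>\<close>.
\<close>

abbreviation data_space :: "nat \<Rightarrow> 'z measure \<Rightarrow> (nat \<Rightarrow> 'z) measure" where
  "data_space N S \<equiv> PiM {1..N} (\<lambda>_. S)"

definition sample :: "nat \<Rightarrow> (nat \<Rightarrow> 'w \<Rightarrow> 'z) \<Rightarrow> 'w \<Rightarrow> nat \<Rightarrow> 'z" where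
  "sample N Z \<omega> = (\<lambda>i\<in>{1..N}. Z i \<omega>)"

definition exchangeable :: "'w measure \<Rightarrow> 'z measure \<Rightarrow> nat \<Rightarrow> (nat \<Rightarrow> 'w \<Rightarrow> 'z) \<Rightarrow> bool" where
  "exchangeable M S N Z \<longleftrightarrow>
     (\<forall>\<sigma>. \<sigma> permutes {1..N} \<longrightarrow>
        distr M (data_space N S) (sample N (\<lambda>i. Z (\<sigma> i))) = distr M (data_space N S) (sample N Z))"

text \<open>\<open>prob_given M MD D E\<close> is (a version of) the conditional probability of the event \<open>E\<close> given the
  sigma-algebra generated by \<open>D\<close>.\<close>

definition prob_given :: "'w measure \<Rightarrow> 'd measure \<Rightarrow> ('w \<Rightarrow> 'd) \<Rightarrow> 'w set \<Rightarrow> 'w \<Rightarrow> real" where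
  "prob_given M MD D E = real_cond_exp M (vimage_algebra (space M) D MD) (indicator E)"

text \<open>The null set in the following definition may depend on the event \<open>A\<close>, because a regular
  conditional distribution need not exist on an arbitrary measurable space.\<close>

definition exchangeable_given ::
  "'w measure \<Rightarrow> 'z measure \<Rightarrow> nat \<Rightarrow> (nat \<Rightarrow> 'w \<Rightarrow> 'z) \<Rightarrow> 'd measure \<Rightarrow> ('w \<Rightarrow> 'd) \<Rightarrow> bool" where
  "exchangeable_given M S N Z MD D \<longleftrightarrow>
     (\<forall>\<sigma>. \<sigma> permutes {1..N} \<longrightarrow> (\<forall>A\<in>sets (data_space N S). AE \<omega> in M.
        prob_given M MD D (sample N (\<lambda>i. Z (\<sigma> i)) -` A \<inter> space M) \<omega> =
        prob_given M MD D (sample N Z -` A \<inter> space M) \<omega>))"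

text \<open>A mapping on \<open>\<X>\<close> indexed by the data and by the auxiliary data. The second conjunct is
  a property of \<open>Z\<close> and \<open>D\<close> only and not of \<open>G\<close>.\<close>

definition permutation_invariant ::
  "'w measure \<Rightarrow> 'z measure \<Rightarrow> nat \<Rightarrow> (nat \<Rightarrow> 'w \<Rightarrow> 'z) \<Rightarrow> 'd measure \<Rightarrow> ('w \<Rightarrow> 'd) \<Rightarrow> 'x set \<Rightarrow>
   ((nat \<Rightarrow> 'z) \<Rightarrow> 'd \<Rightarrow> 'x \<Rightarrow> 'g) \<Rightarrow> bool" where
  "permutation_invariant M S N Z MD D \<X> G \<longleftrightarrow>
     (\<forall>d\<in>space MD. \<forall>z\<in>space (data_space N S). \<forall>\<sigma>. \<sigma> permutes {1..N} \<longrightarrow>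
        (\<forall>x\<in>\<X>. G z d x = G (z \<circ> \<sigma>) d x)) \<and>
     (exchangeable M S N Z \<longrightarrow> exchangeable_given M S N Z MD D)"

text \<open>In the definitions below \<open>z\<close> is a realized data set, \<open>C\<close> and \<open>T\<close> are the constructor and the
  trust score already evaluated at the data and the auxiliary data, and \<open>u\<close> holds the realized
  uniform variables.\<close>

definition covered :: "(nat \<Rightarrow> 'x \<times> 'y) \<Rightarrow> ('x \<Rightarrow> 'y set) \<Rightarrow> nat \<Rightarrow> bool" where
  "covered z C i \<longleftrightarrow> snd (z i) \<in> C (fst (z i))"

definition trust :: "(nat \<Rightarrow> 'x \<times> 'y) \<Rightarrow> ('x \<Rightarrow> 'y set) \<Rightarrow> ('x \<Rightarrow> 'y set \<Rightarrow> real) \<Rightarrow> nat \<Rightarrow> real" where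
  "trust z C T i = T (fst (z i)) (C (fst (z i)))"

definition gc_pvalue ::
  "nat \<Rightarrow> (nat \<Rightarrow> 'x \<times> 'y) \<Rightarrow> ('x \<Rightarrow> 'y set) \<Rightarrow> ('x \<Rightarrow> 'y set \<Rightarrow> real) \<Rightarrow> (nat \<Rightarrow> real) \<Rightarrow> nat \<Rightarrow> real" where
  "gc_pvalue n z C T u j =
     ((\<Sum>i=1..n. of_bool (\<not> covered z C i \<and> trust z C T i > trust z C T (n + j))) +
      (1 + (\<Sum>i=1..n. of_bool (\<not> covered z C i \<and> trust z C T i = trust z C T (n + j)))) * u j)
     / (real n + 1)"

definition scip_level :: "real \<Rightarrow> nat \<Rightarrow> (nat \<Rightarrow> real) \<Rightarrow> real" where
  "scip_level \<alpha> m p =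
     (GREATEST a. a \<in> {0..1} \<and> \<alpha> / real m * (\<Sum>j=1..m. of_bool (p j \<le> a)) \<ge> a)"

definition scip_selected :: "real \<Rightarrow> nat \<Rightarrow> (nat \<Rightarrow> real) \<Rightarrow> nat set" where
  "scip_selected \<alpha> m p = {j\<in>{1..m}. p j \<le> scip_level \<alpha> m p}"

definition false_coverage_proportion ::
  "nat \<Rightarrow> nat \<Rightarrow> real \<Rightarrow> (nat \<Rightarrow> 'x \<times> 'y) \<Rightarrow> ('x \<Rightarrow> 'y set) \<Rightarrow> ('x \<Rightarrow> 'y set \<Rightarrow> real) \<Rightarrow> (nat \<Rightarrow> real) \<Rightarrow> real"
  where
  "false_coverage_proportion n m \<alpha> z C T u =
     (let \<S> = scip_selected \<alpha> m (gc_pvalue n z C T u)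
      in (\<Sum>j\<in>\<S>. of_bool (\<not> covered z C (n + j))) / real (max 1 (card \<S>)))"

definition FCR ::
  "'w measure \<Rightarrow> nat \<Rightarrow> nat \<Rightarrow> real \<Rightarrow> (nat \<Rightarrow> 'w \<Rightarrow> 'x \<times> 'y) \<Rightarrow> ('w \<Rightarrow> 'd) \<Rightarrow>
   ((nat \<Rightarrow> 'x \<times> 'y) \<Rightarrow> 'd \<Rightarrow> 'x \<Rightarrow> 'y set) \<Rightarrow>
   ((nat \<Rightarrow> 'x \<times> 'y) \<Rightarrow> 'd \<Rightarrow> 'x \<Rightarrow> 'y set \<Rightarrow> real) \<Rightarrow> (nat \<Rightarrow> 'w \<Rightarrow> real) \<Rightarrow> real" where
  "FCR M n m \<alpha> Z D C T U =
     (LINT \<omega>|M. false_coverage_proportion n m \<alpha> (sample (n + m) Z \<omega>)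
        (C (sample (n + m) Z \<omega>) (D \<omega>)) (T (sample (n + m) Z \<omega>) (D \<omega>)) (\<lambda>j. U j \<omega>))"

text \<open>The maximum defining the level is attained, so \<open>GREATEST\<close> denotes it.\<close>

lemma scip_level_is_max:
  fixes \<alpha> :: real and p :: "nat \<Rightarrow> real"
  assumes "0 \<le> \<alpha>" "\<alpha> \<le> 1" "1 \<le> m"
  defines "P \<equiv> \<lambda>a. a \<in> {0..1} \<and> \<alpha> / real m * (\<Sum>j=1..m. of_bool (p j \<le> a)) \<ge> a"
  shows "P (scip_level \<alpha> m p) \<and> (\<forall>a. P a \<longrightarrow> a \<le> scip_level \<alpha> m p)"
proof -
  define R where "R a = (\<Sum>j=1..m. of_bool (p j \<le> a) :: real)" for a
  define f where "f k = \<alpha> / real m * real k" for k :: nat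
  have R_eq: "R a = real (card {j\<in>{1..m}. p j \<le> a})" for a
    by (simp add: R_def of_bool_def sum.If_cases Int_def)
  have R_le: "card {j\<in>{1..m}. p j \<le> a} \<le> m" for a
    using card_mono[of "{1..m}" "{j\<in>{1..m}. p j \<le> a}"]
    by (metis (no_types, lifting) card_atLeastAtMost diff_Suc_1 finite_atLeastAtMost mem_Collect_eq subsetI)
  have R_mono: "R a \<le> R b" if "a \<le> b" for a b
    unfolding R_def using that by (intro sum_mono) auto
  have P_eq: "P a \<longleftrightarrow> 0 \<le> a \<and> a \<le> 1 \<and> a \<le> \<alpha> / real m * R a" for a
    by (auto simp: P_def R_def)
  have f_le: "f k \<le> 1" if "k \<le> m" for k
    using mult_mono[of \<alpha> 1 "real k" "real m"] that assms by (simp add: f_def field_simps)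
  have bound: "\<exists>k\<le>m. P (f k) \<and> a \<le> f k" if "P a" for a
  proof -
    define k where "k = card {j\<in>{1..m}. p j \<le> a}"
    have fk: "f k = \<alpha> / real m * R a" by (simp add: f_def k_def R_eq)
    have "a \<le> f k" using that P_eq fk by simp
    moreover have "f k \<le> \<alpha> / real m * R (f k)"
      unfolding fk using R_mono[OF \<open>a \<le> f k\<close>] assms unfolding fk by (intro mult_left_mono) auto
    moreover have "k \<le> m" unfolding k_def by (rule R_le)
    moreover have "0 \<le> f k" using assms(1) by (simp add: f_def)
    ultimately show ?thesis using f_le[of k] P_eq[of "f k"] by blast
  qed
  define K where "K = {k. k \<le> m \<and> P (f k)}"
  have "P 0" using assms by (auto simp: P_eq R_eq)
  then have K: "finite K" "K \<noteq> {}" using bound by (auto simp: K_def)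
  have "Max (f ` K) \<in> f ` K" using K by (intro Max_in) auto
  moreover have "f ` K \<subseteq> Collect P" by (auto simp: K_def)
  ultimately have "P (Max (f ` K))" by blast
  moreover have "a \<le> Max (f ` K)" if "P a" for a
  proof -
    from bound[OF that] obtain k where "k \<in> K" "a \<le> f k" by (auto simp: K_def)
    then show ?thesis using K by (meson Max_ge finite_imageI imageI order_trans)
  qed
  moreover have "scip_level \<alpha> m p = Greatest P" by (simp add: scip_level_def P_def)
  ultimately show ?thesis using Greatest_equality[of P "Max (f ` K)"] by metis
qed

end

theory Submission
  imports Defs
begin

text \<open>
  A selected index \<open>j\<close> satisfies \<open>p j \<le> \<alpha> R / m\<close>, where the number \<open>R\<close> of selections
  does not change when \<open>p j\<close> is replaced by 0. Condition on the auxiliary data, on all data except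
  for the order of the calibration points and the \<open>j\<close>-th test point, and on the other uniform
  variables. By exchangeability each of these \<open>n + 1\<close> points is equally likely to be the test point,
  and both the leave-one-out count \<open>R\<close> and the rank in trust of a miscovered test point are
  monotone in its trust score. So the point of least trust that can still be selected has the smallest
  \<open>R\<close>, and comparing with it bounds the conditional contribution of \<open>j\<close> by \<open>\<alpha> / m\<close>.
\<close>

section \<open>Step-up rejection counts\<close>

text \<open>The rejection number of the Benjamini-Hochberg procedure. The candidates include 0 and
  are bounded by \<open>m\<close>, so \<open>GREATEST\<close> is attained. A count is easier to
  compare and to divide by than the real level, which is recovered as
  \<open>\<alpha> / real m\<close> times the count.\<close>

definition bh_count :: "real \<Rightarrow> nat \<Rightarrow> (nat \<Rightarrow> real) \<Rightarrow> nat" where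
  "bh_count \<alpha> m p = (GREATEST k. k \<le> card {j\<in>{1..m}. p j \<le> \<alpha> / real m * real k})"

lemma card_filter_interval_le: "card {j\<in>{1..m}. P j} \<le> m"
  using card_mono[of "{1..m}" "{j\<in>{1..m}. P j}"] by (simp add: subset_iff)

lemma le_bh_count:
  assumes "k \<le> card {j\<in>{1..m}. p j \<le> \<alpha> / real m * real k}"
  shows "k \<le> bh_count \<alpha> m p"
  unfolding bh_count_def
  using assms by (rule Greatest_le_nat[of _ _ m]) (rule le_trans[OF _ card_filter_interval_le])

text \<open>The number of p-values below the threshold grows with \<open>k\<close>. Hence if
  \<open>k\<close> is a candidate, so is the number of p-values below its threshold, and the
  greatest candidate must be a fixed point.\<close>

lemma card_bh_count:
  assumes "0 \<le> \<alpha>"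
  shows "card {j\<in>{1..m}. p j \<le> \<alpha> / real m * real (bh_count \<alpha> m p)} = bh_count \<alpha> m p"
proof (rule antisym)
  let ?c = "\<lambda>k. card {j\<in>{1..m}. p j \<le> \<alpha> / real m * real k}"
  show *: "bh_count \<alpha> m p \<le> ?c (bh_count \<alpha> m p)"
    unfolding bh_count_def
    by (rule GreatestI_nat[of _ 0 m]) (simp, rule le_trans[OF _ card_filter_interval_le])
  have "\<alpha> / real m * real (bh_count \<alpha> m p) \<le> \<alpha> / real m * real (?c (bh_count \<alpha> m p))"
    using * assms by (intro mult_left_mono) auto
  then have "?c (bh_count \<alpha> m p) \<le> ?c (?c (bh_count \<alpha> m p))"
    by (intro card_mono) auto
  then show "?c (bh_count \<alpha> m p) \<le> bh_count \<alpha> m p" by (rule le_bh_count)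
qed

lemma bh_count_le: "0 \<le> \<alpha> \<Longrightarrow> bh_count \<alpha> m p \<le> m"
  by (metis card_bh_count card_filter_interval_le)

text \<open>An admissible level can be raised to the multiple of \<open>\<alpha> / real m\<close>
  given by its own count, so the maximum is such a multiple. The bound
  \<open>\<alpha> \<le> 1\<close> keeps these multiples in the unit interval.\<close>

lemma scip_level_eq_bh_count:
  assumes "0 \<le> \<alpha>" "\<alpha> \<le> 1" "1 \<le> m"
  shows "scip_level \<alpha> m p = \<alpha> / real m * real (bh_count \<alpha> m p)"
proof -
  let ?l = "scip_level \<alpha> m p" and ?c = "\<lambda>a. card {j\<in>{1..m}. p j \<le> a}"
  have sum_eq: "(\<Sum>j=1..m. of_bool (p j \<le> a)) = real (?c a)" for a
    by (simp add: of_bool_def sum.If_cases Int_def)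
  have P: "?l \<in> {0..1}" "?l \<le> \<alpha> / real m * real (?c ?l)"
    and max: "\<And>a. a \<in> {0..1} \<Longrightarrow> a \<le> \<alpha> / real m * real (?c a) \<Longrightarrow> a \<le> ?l"
    using scip_level_is_max[OF assms, of p] unfolding sum_eq by blast+
  have "?c ?l \<le> ?c (\<alpha> / real m * real (?c ?l))"
    using P(2) by (intro card_mono) auto
  then have "?c ?l \<le> bh_count \<alpha> m p" by (rule le_bh_count)
  then have "?l \<le> \<alpha> / real m * real (bh_count \<alpha> m p)"
    using P(2) assms by (meson divide_nonneg_nonneg mult_left_mono of_nat_0_le_iff of_nat_mono order_trans)
  moreover have "\<alpha> / real m * real (bh_count \<alpha> m p) \<le> 1"
    using mult_mono[of \<alpha> 1 "real (bh_count \<alpha> m p)" "real m"] bh_count_le[of \<alpha> m p] assms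
    by (simp add: field_simps)
  then have "\<alpha> / real m * real (bh_count \<alpha> m p) \<le> ?l"
    using assms card_bh_count[of \<alpha> m p] by (intro max) auto
  ultimately show ?thesis by simp
qed

lemma bh_count_antimono:
  assumes "0 \<le> \<alpha>" "\<And>j. j \<in> {1..m} \<Longrightarrow> p j \<le> q j"
  shows "bh_count \<alpha> m q \<le> bh_count \<alpha> m p"
proof (rule le_bh_count)
  let ?x = "\<alpha> / real m * real (bh_count \<alpha> m q)"
  have "card {j\<in>{1..m}. q j \<le> ?x} \<le> card {j\<in>{1..m}. p j \<le> ?x}"
    using assms(2) by (intro card_mono) (auto intro: order_trans)
  then show "bh_count \<alpha> m q \<le> card {j\<in>{1..m}. p j \<le> ?x}"
    using card_bh_count[OF assms(1), of m q] by simp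
qed

text \<open>Lowering \<open>p j\<close> to 0 cannot decrease the count, so the new threshold is at
  least the old one, which \<open>p j\<close> already met. At the new threshold both families
  therefore reject the same indices, and the new count is a candidate for \<open>p\<close>.\<close>

lemma bh_count_leave_one_out:
  assumes "0 \<le> \<alpha>" "0 \<le> p j" "p j \<le> \<alpha> / real m * real (bh_count \<alpha> m p)"
  shows "bh_count \<alpha> m (p(j := 0)) = bh_count \<alpha> m p"
proof (rule antisym)
  let ?k = "bh_count \<alpha> m (p(j := 0))"
  show *: "bh_count \<alpha> m p \<le> ?k"
    using assms by (intro bh_count_antimono) auto
  show "?k \<le> bh_count \<alpha> m p"
  proof (rule le_bh_count)
    have "\<alpha> / real m * real (bh_count \<alpha> m p) \<le> \<alpha> / real m * real ?k"
      using * assms by (intro mult_left_mono) auto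
    then have "p j \<le> \<alpha> / real m * real ?k" using assms(3) by linarith
    then have "{l\<in>{1..m}. (p(j := 0)) l \<le> \<alpha> / real m * real ?k} = {l\<in>{1..m}. p l \<le> \<alpha> / real m * real ?k}"
      using assms by auto
    then show "?k \<le> card {l\<in>{1..m}. p l \<le> \<alpha> / real m * real ?k}"
      using card_bh_count[OF assms(1), of m "p(j := 0)"] by simp
  qed
qed

text \<open>Makes leave-one-out counts usable as denominators: a p-value 0 passes the threshold for
  \<open>k = 1\<close>.\<close>

lemma bh_count_pos:
  assumes "0 \<le> \<alpha>" "j \<in> {1..m}" "p j = 0"
  shows "1 \<le> bh_count \<alpha> m p"
proof (rule le_bh_count)
  have "card {j} \<le> card {l\<in>{1..m}. p l \<le> \<alpha> / real m * real 1}"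
    using assms by (intro card_mono) auto
  then show "1 \<le> card {l\<in>{1..m}. p l \<le> \<alpha> / real m * real 1}" by simp
qed

section \<open>P-values and the contribution of each test point\<close>

text \<open>In terms of the miscoverage indicators \<open>b\<close> and the trust scores \<open>s\<close> of all \<open>n + m\<close> points.\<close>

definition pval :: "nat \<Rightarrow> (nat \<Rightarrow> bool) \<Rightarrow> (nat \<Rightarrow> real) \<Rightarrow> (nat \<Rightarrow> real) \<Rightarrow> nat \<Rightarrow> real" where
  "pval n b s u j =
     ((\<Sum>i=1..n. of_bool (b i \<and> s i > s (n + j))) +
      (1 + (\<Sum>i=1..n. of_bool (b i \<and> s i = s (n + j)))) * u j) / (real n + 1)"

lemma gc_pvalue_eq_pval:
  "gc_pvalue n z C T u = pval n (\<lambda>i. \<not> covered z C i) (trust z C T) u"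
  by (simp add: fun_eq_iff gc_pvalue_def pval_def)

text \<open>The term of test point \<open>j\<close> in the false coverage proportion. For
  \<open>j\<close> in \<open>{1..m}\<close> and nonnegative \<open>\<alpha>\<close>, the
  \<open>max 1\<close> takes effect only when nothing is rejected, and then the numerator is
  0.\<close>

definition miscoverage_share ::
  "real \<Rightarrow> nat \<Rightarrow> nat \<Rightarrow> nat \<Rightarrow> (nat \<Rightarrow> bool) \<Rightarrow> (nat \<Rightarrow> real) \<Rightarrow> (nat \<Rightarrow> real) \<Rightarrow> real" where
  "miscoverage_share \<alpha> n m j b s u =
     of_bool (b (n + j) \<and> pval n b s u j \<le> \<alpha> / real m * real (bh_count \<alpha> m (pval n b s u)))
       / real (max 1 (bh_count \<alpha> m (pval n b s u)))"

lemma miscoverage_share_nonneg: "0 \<le> miscoverage_share \<alpha> n m j b s u"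
  by (simp add: miscoverage_share_def)

text \<open>By the fixed point property of \<open>bh_count\<close>, the size of the selected set is
  the count itself, so all terms have the same denominator.\<close>

lemma false_coverage_proportion_eq_sum:
  assumes "0 \<le> \<alpha>" "\<alpha> \<le> 1" "1 \<le> m"
  shows "false_coverage_proportion n m \<alpha> z C T u =
    (\<Sum>j=1..m. miscoverage_share \<alpha> n m j (\<lambda>i. \<not> covered z C i) (trust z C T) u)"
proof -
  let ?p = "gc_pvalue n z C T u"
  let ?x = "\<alpha> / real m * real (bh_count \<alpha> m ?p)"
  have S: "scip_selected \<alpha> m ?p = {j\<in>{1..m}. ?p j \<le> ?x}"
    by (simp add: scip_selected_def scip_level_eq_bh_count[OF assms])
  have "false_coverage_proportion n m \<alpha> z C T u =
    (\<Sum>j\<in>{j\<in>{1..m}. ?p j \<le> ?x}. of_bool (\<not> covered z C (n + j))) / real (max 1 (bh_count \<alpha> m ?p))"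
    by (simp only: false_coverage_proportion_def Let_def S card_bh_count[OF assms(1)])
  also have "(\<Sum>j\<in>{j\<in>{1..m}. ?p j \<le> ?x}. of_bool (\<not> covered z C (n + j)) :: real) =
      (\<Sum>j=1..m. of_bool (\<not> covered z C (n + j) \<and> ?p j \<le> ?x))"
    by (simp add: Int_def conj_ac)
  finally show ?thesis
    by (simp only: sum_divide_distrib miscoverage_share_def gc_pvalue_eq_pval[symmetric])
qed

section \<open>Swapping the test point with a calibration point, for fixed data\<close>

text \<open>After the swap point \<open>i\<close> sits in the test position, and the calibration
  positions hold the other \<open>n\<close> of the \<open>n + 1\<close> points. The case
  \<open>i = n + j\<close> is the trivial swap.\<close>

lemma sum_calibration_transpose:
  fixes f :: "nat \<Rightarrow> real"
  assumes "1 \<le> j" "i \<in> insert (n + j) {1..n}"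
  shows "(\<Sum>k=1..n. f (Transposition.transpose i (n + j) k)) = (\<Sum>k\<in>insert (n + j) {1..n}. f k) - f i"
proof -
  have "inj_on (Transposition.transpose i (n + j)) {1..n}"
    by (rule inj_on_subset[OF bij_is_inj[OF bij_transpose]]) simp
  then have "(\<Sum>k=1..n. f (Transposition.transpose i (n + j) k)) = sum f (Transposition.transpose i (n + j) ` {1..n})"
    by (simp add: sum.reindex)
  also have "Transposition.transpose i (n + j) ` {1..n} = insert (n + j) {1..n} - {i}"
  proof (cases "i = n + j")
    case True then show ?thesis using assms by auto
  next
    case False
    then have i: "i \<in> {1..n}" using assms by auto
    have "Transposition.transpose i (n + j) ` {1..n} = insert (n + j) ({1..n} - {i})"
      using i assms(1) by (auto simp: Transposition.transpose_def image_iff)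
    then show ?thesis using False by auto
  qed
  also have "sum f \<dots> = (\<Sum>k\<in>insert (n + j) {1..n}. f k) - f i"
    using assms(2) by (subst sum_diff1) auto
  finally show ?thesis .
qed

text \<open>The numerator of a p-value is affine in its uniform variable, so this gives the
  probability of selection for a fixed leave-one-out count.\<close>

lemma emeasure_uniform_affine_le:
  fixes a c x :: real
  assumes "0 < c"
  shows "emeasure (uniform_measure lborel {0<..<1}) {t. a + c * t \<le> x} = ennreal (max 0 (min 1 ((x - a) / c)))"
proof -
  have eq: "{t. a + c * t \<le> x} = {..(x - a) / c}"
    using assms by (auto simp: field_simps)
  let ?y = "(x - a) / c"
  consider "?y \<le> 0" | "0 < ?y" "?y < 1" | "1 \<le> ?y" by linarith
  then have "emeasure lborel ({0<..<1} \<inter> {..?y}) = ennreal (max 0 (min 1 ?y))"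
  proof cases
    case 1
    then have "{0<..<1} \<inter> {..?y} = {}" by auto
    then show ?thesis using 1 by simp
  next
    case 2
    then have "{0<..<1} \<inter> {..?y} = {0<..?y}" by auto
    then show ?thesis using 2 by simp
  next
    case 3
    then have "{0<..<1} \<inter> {..?y} = {0<..<1}" by auto
    then show ?thesis using 3 by simp
  qed
  then show ?thesis unfolding eq by (simp add: emeasure_uniform_measure divide_ennreal_def)
qed

text \<open>In the application \<open>J\<close> consists of the miscovered points, and \<open>L i\<close> is the probability,
  over the uniform variable, that \<open>i\<close> is selected when it is the test point.\<close>

lemma sum_clamp_le:
  fixes s R :: "nat \<Rightarrow> real" and y :: real
  assumes "finite J" "0 \<le> y" and pos: "\<And>i. i \<in> J \<Longrightarrow> 0 < R i"
    and mono: "\<And>i k. i \<in> J \<Longrightarrow> k \<in> J \<Longrightarrow> s i \<le> s k \<Longrightarrow> R i \<le> R k"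
  defines "a \<equiv> \<lambda>i. real (card {k\<in>J. s k > s i})" and "c \<equiv> \<lambda>i. real (card {k\<in>J. s k = s i})"
  defines "L \<equiv> \<lambda>i. max 0 (min 1 ((y * R i - a i) / c i))"
  shows "(\<Sum>i\<in>J. L i / R i) \<le> y"
proof (cases "\<exists>i\<in>J. 0 < L i")
  case False
  then have "(\<Sum>i\<in>J. L i / R i) \<le> (\<Sum>i\<in>J. 0)"
    using pos by (intro sum_mono) (auto simp: divide_le_0_iff not_less less_imp_le)
  then show ?thesis using assms(2) by simp
next
  case True
  \<comment> \<open>The points that can be selected with positive probability; \<open>e\<close>
    below is one of least trust among them.\<close>
  define J' where "J' = {i\<in>J. 0 < L i}"
  have "finite J'" "J' \<noteq> {}" using True assms(1) by (auto simp: J'_def)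
  then have "Min (s ` J') \<in> s ` J'" "\<forall>k\<in>J'. Min (s ` J') \<le> s k" by simp_all
  then obtain e where "e \<in> J'" "\<forall>k\<in>J'. s e \<le> s k" by auto
  then have e: "e \<in> J" "0 < L e" and least: "\<And>k. k \<in> J \<Longrightarrow> 0 < L k \<Longrightarrow> s e \<le> s k"
    by (auto simp: J'_def)
  have L_bounds: "0 \<le> L i" "L i \<le> 1" for i by (auto simp: L_def)
  have L_zero: "L i = 0" if "i \<in> J" "s i < s e" for i
    using least[OF that(1)] that(2) L_bounds(1)[of i] by linarith
  have c_pos: "0 < c e"
    using e assms(1) by (auto simp: c_def card_gt_0_iff)
  \<comment> \<open>Monotonicity applied in both directions shows that points of equal trust have
    equal \<open>R\<close>.\<close>
  have L_eq: "L i = L e" if "i \<in> J" "s i = s e" for i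
  proof -
    have "R i = R e" using mono[of i e] mono[of e i] that e by (simp add: antisym)
    then show ?thesis using that by (simp add: L_def a_def c_def)
  qed
  \<comment> \<open>Terms below \<open>e\<close> vanish, and from \<open>e\<close> upwards
    \<open>R i\<close> is at least \<open>R e\<close>, so all denominators can be replaced by
    \<open>R e\<close>.\<close>
  have "(\<Sum>i\<in>J. L i / R i) \<le> (\<Sum>i\<in>J. L i / R e)"
  proof (rule sum_mono)
    fix i assume i: "i \<in> J"
    show "L i / R i \<le> L i / R e"
    proof (cases "s i < s e")
      case True then show ?thesis using L_zero i by simp
    next
      case False
      then show ?thesis using mono[of e i] i e pos[of e] L_bounds(1)[of i]
        by (intro divide_left_mono) (auto intro!: mult_pos_pos pos)
    qed
  qed
  also have "\<dots> = (\<Sum>i\<in>J. L i) / R e" by (simp add: sum_divide_distrib)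
  \<comment> \<open>Points above \<open>e\<close> count at most 1 each, points tied with
    \<open>e\<close> count \<open>L e\<close>, points below count 0.\<close>
  also have "(\<Sum>i\<in>J. L i) \<le> (\<Sum>i\<in>J. of_bool (s i > s e) + of_bool (s i = s e) * L e)"
    using L_zero L_eq L_bounds by (intro sum_mono) (auto simp: of_bool_def not_less le_less)
  also have "\<dots> = a e + c e * L e"
    using assms(1)
    by (simp add: sum.distrib sum_distrib_right[symmetric] a_def c_def of_bool_def sum.If_cases Int_def)
  \<comment> \<open>Since \<open>L e\<close> is positive, the clamp at 0 is inactive and
    \<open>L e\<close> is at most the quotient inside it.\<close>
  also have "\<dots> \<le> a e + c e * ((y * R e - a e) / c e)"
    using e(2) c_pos by (intro add_left_mono mult_left_mono) (auto simp: L_def max_def split: if_splits)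
  also have "\<dots> = y * R e" using c_pos by simp
  finally show ?thesis using pos[OF e(1)] by (simp add: divide_right_mono divide_le_eq)
qed

text \<open>The conditional bound in its deterministic form: each of the \<open>n + 1\<close> points
  takes the test position once, and only the \<open>j\<close>-th uniform variable is integrated.
  Dividing by \<open>n + 1\<close> yields the contribution \<open>\<alpha> / real m\<close>.\<close>

lemma sum_miscoverage_share_le:
  fixes n m j :: nat and \<alpha> :: real and b :: "nat \<Rightarrow> bool" and s u :: "nat \<Rightarrow> real"
  assumes \<alpha>: "0 \<le> \<alpha>" and j: "j \<in> {1..m}" and u: "\<And>l. l \<in> {1..m} - {j} \<Longrightarrow> 0 \<le> u l \<and> u l \<le> 1"
  defines "I \<equiv> insert (n + j) {1..n}" and "\<tau> \<equiv> \<lambda>i. Transposition.transpose i (n + j)"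
  shows "(\<Sum>i\<in>I. \<integral>\<^sup>+ t. ennreal (miscoverage_share \<alpha> n m j (b \<circ> \<tau> i) (s \<circ> \<tau> i) (u(j := t)))
           \<partial>uniform_measure lborel {0<..<1}) \<le> ennreal (\<alpha> * (real n + 1) / real m)"
proof -
  let ?V = "uniform_measure lborel {0<..<1::real}"
  define J where "J = {i\<in>I. b i}"
  define p where "p i t = pval n (b \<circ> \<tau> i) (s \<circ> \<tau> i) (u(j := t))" for i t
  \<comment> \<open>The argument 0 of \<open>p i\<close> is arbitrary: it enters only the
    \<open>j\<close>-th p-value, which is overwritten.\<close>
  define R where "R i = real (bh_count \<alpha> m ((p i 0)(j := 0)))" for i
  \<comment> \<open>Clearing the denominator \<open>n + 1\<close> of the p-value turns the threshold
    \<open>\<alpha> / real m * R i\<close> into \<open>y * R i\<close>.\<close>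
  define y where "y = \<alpha> * (real n + 1) / real m"
  define a where "a i = real (card {k\<in>J. s k > s i})" for i
  define c where "c i = real (card {k\<in>J. s k = s i})" for i
  define L where "L i = max 0 (min 1 ((y * R i - a i) / c i))" for i
  have fin: "finite I" "finite J" by (simp_all add: I_def J_def)
  have y: "0 \<le> y" using \<alpha> by (simp add: y_def)
  have j1: "1 \<le> j" using j by simp
  have tau_j: "\<tau> i (n + j) = i" for i by (simp add: \<tau>_def)
  have sum_tau: "(\<Sum>k=1..n. f (\<tau> i k)) = sum f I - f i" if "i \<in> I" for f :: "nat \<Rightarrow> real" and i
    unfolding \<tau>_def I_def using sum_calibration_transpose[OF j1, of i n f] that by (simp add: I_def)
  have sum_J: "(\<Sum>k\<in>I. of_bool (b k \<and> P k)) = real (card {k\<in>J. P k})" for P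
    using fin by (simp add: of_bool_def sum.If_cases Int_def J_def conj_ac)
  \<comment> \<open>Point \<open>i\<close> is miscovered and missing from the calibration positions;
    the \<open>1 +\<close> in \<open>pval\<close> restores it to its tie class, so both counts run
    over all of \<open>J\<close>.\<close>
  have p_j: "p i t j = (a i + c i * t) / (real n + 1)" if "i \<in> J" for i t
  proof -
    have i: "i \<in> I" "b i" using that by (auto simp: J_def)
    show ?thesis
      using sum_tau[OF i(1), of "\<lambda>k. of_bool (b k \<and> s k > s i)"]
        sum_tau[OF i(1), of "\<lambda>k. of_bool (b k \<and> s k = s i)"] i(2)
      by (simp add: p_def pval_def tau_j sum_J a_def c_def)
  qed
  define A where "A l = (\<Sum>k\<in>I. of_bool (b k \<and> s k > s (n + l)) :: real)" for l
  define E where "E l = (\<Sum>k\<in>I. of_bool (b k \<and> s k = s (n + l)) :: real)" for l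
  \<comment> \<open>The swap fixes the other test positions. With \<open>A\<close> and
    \<open>E\<close> counting over all \<open>n + 1\<close> points, \<open>i\<close> enters only
    through the terms removed for it.\<close>
  have p_l: "p i t l = (A l - of_bool (s i > s (n + l)) + (1 + E l - of_bool (s i = s (n + l))) * u l) / (real n + 1)"
    if "i \<in> J" "l \<in> {1..m} - {j}" for i t l
  proof -
    have i: "i \<in> I" "b i" using that by (auto simp: J_def)
    have "\<tau> i (n + l) = n + l"
      using that i by (auto simp: \<tau>_def I_def Transposition.transpose_def)
    then show ?thesis
      using sum_tau[OF i(1), of "\<lambda>k. of_bool (b k \<and> s k > s (n + l))"]
        sum_tau[OF i(1), of "\<lambda>k. of_bool (b k \<and> s k = s (n + l))"] i(2) that(2)
      by (simp add: p_def pval_def A_def E_def del: sum_of_bool_eq)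
  qed
  have R_pos: "1 \<le> R i" for i
    using bh_count_pos[OF \<alpha> j, of "(p i 0)(j := 0)"] by (simp add: R_def)
  have R_mono: "R i \<le> R k" if "i \<in> J" "k \<in> J" "s i \<le> s k" for i k
    unfolding R_def
  proof (intro of_nat_mono bh_count_antimono \<alpha>)
    fix l assume l: "l \<in> {1..m}"
    show "((p k 0)(j := 0)) l \<le> ((p i 0)(j := 0)) l"
    proof (cases "l = j")
      case False
      then have l': "l \<in> {1..m} - {j}" using l by simp
      \<comment> \<open>As the trust of the removed point rises past that of \<open>n + l\<close>,
        the amount subtracted goes from 0 through \<open>u l\<close> to 1. Hence the other p-values
        decrease and the count increases.\<close>
      have "- of_bool (s k > s (n + l)) - of_bool (s k = s (n + l)) * u l
          \<le> - of_bool (s i > s (n + l)) - of_bool (s i = s (n + l)) * u l"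
        using u[OF l'] that(3) by (auto simp: of_bool_def)
      then show ?thesis
        using False by (auto simp: p_l[OF that(1) l'] p_l[OF that(2) l'] algebra_simps intro!: divide_right_mono)
    qed simp
  qed
  have share_le: "miscoverage_share \<alpha> n m j (b \<circ> \<tau> i) (s \<circ> \<tau> i) (u(j := t))
      \<le> of_bool (a i + c i * t \<le> y * R i) / R i" if "i \<in> J" "0 \<le> t" for i t
  proof -
    let ?K = "bh_count \<alpha> m (p i t)"
    have "0 \<le> p i t j" using that by (simp add: p_j a_def c_def)
    moreover have "bh_count \<alpha> m ((p i t)(j := 0)) = bh_count \<alpha> m ((p i 0)(j := 0))"
    proof -
      have "(p i t)(j := 0) = (p i 0)(j := 0)" by (auto simp: p_def pval_def fun_eq_iff)
      then show ?thesis by simp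
    qed
    \<comment> \<open>On selection the actual count equals the leave-one-out count, which does not
      depend on \<open>t\<close>.\<close>
    ultimately have K: "real ?K = R i" if "p i t j \<le> \<alpha> / real m * real ?K"
      using bh_count_leave_one_out[OF \<alpha>, of "p i t" j m] that by (simp add: R_def)
    have le: "a i + c i * t \<le> y * R i" if "p i t j \<le> \<alpha> / real m * real ?K"
    proof -
      have "(a i + c i * t) / (real n + 1) \<le> \<alpha> / real m * R i"
        using that K[OF that] p_j[OF \<open>i \<in> J\<close>, of t] by simp
      then have "a i + c i * t \<le> \<alpha> / real m * R i * (real n + 1)"
        by (simp add: divide_le_eq)
      then show ?thesis by (simp add: y_def mult_ac)
    qed
    show ?thesis
    proof (cases "p i t j \<le> \<alpha> / real m * real ?K")
      case True
      have "real (max 1 ?K) = R i" using K[OF True] R_pos[of i] by auto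
      then show ?thesis
        using le[OF True] R_pos[of i] by (auto simp: miscoverage_share_def p_def[symmetric] of_bool_def)
    next
      case False
      then show ?thesis using R_pos[of i] by (simp add: miscoverage_share_def p_def[symmetric])
    qed
  qed
  have int_le: "(\<integral>\<^sup>+ t. ennreal (miscoverage_share \<alpha> n m j (b \<circ> \<tau> i) (s \<circ> \<tau> i) (u(j := t))) \<partial>?V)
      \<le> ennreal (L i / R i)" if i: "i \<in> J" for i
  proof -
    have "0 < c i" using i fin by (auto simp: c_def card_gt_0_iff)
    have "AE t in ?V. t \<in> {0<..<1}"
      by (rule AE_uniform_measureI) auto
    then have "(\<integral>\<^sup>+ t. ennreal (miscoverage_share \<alpha> n m j (b \<circ> \<tau> i) (s \<circ> \<tau> i) (u(j := t))) \<partial>?V)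
        \<le> (\<integral>\<^sup>+ t. ennreal (1 / R i) * indicator {t. a i + c i * t \<le> y * R i} t \<partial>?V)"
    proof (intro nn_integral_mono_AE, elim eventually_mono)
      fix t :: real assume "t \<in> {0<..<1}"
      then show "ennreal (miscoverage_share \<alpha> n m j (b \<circ> \<tau> i) (s \<circ> \<tau> i) (u(j := t)))
        \<le> ennreal (1 / R i) * indicator {t. a i + c i * t \<le> y * R i} t"
        using share_le[OF i, of t] by (auto simp: indicator_def of_bool_def ennreal_neg split: if_splits intro: ennreal_leI)
    qed
    also have "\<dots> = ennreal (1 / R i) * emeasure ?V {t. a i + c i * t \<le> y * R i}"
      by (rule nn_integral_cmult_indicator) simp
    also have "\<dots> = ennreal (L i / R i)"
      using R_pos[of i] unfolding emeasure_uniform_affine_le[OF \<open>0 < c i\<close>]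
      by (subst ennreal_mult[symmetric]) (simp_all add: L_def)
    finally show ?thesis .
  qed
  \<comment> \<open>A covered point in the test position contributes nothing.\<close>
  have "(\<Sum>i\<in>I. \<integral>\<^sup>+ t. ennreal (miscoverage_share \<alpha> n m j (b \<circ> \<tau> i) (s \<circ> \<tau> i) (u(j := t))) \<partial>?V)
     = (\<Sum>i\<in>J. \<integral>\<^sup>+ t. ennreal (miscoverage_share \<alpha> n m j (b \<circ> \<tau> i) (s \<circ> \<tau> i) (u(j := t))) \<partial>?V)"
    using fin by (intro sum.mono_neutral_right) (auto simp: J_def miscoverage_share_def tau_j)
  also have "\<dots> \<le> (\<Sum>i\<in>J. ennreal (L i / R i))" by (intro sum_mono int_le)
  also have "\<dots> = ennreal (\<Sum>i\<in>J. L i / R i)"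
    by (intro sum_ennreal divide_nonneg_nonneg order_trans[OF zero_le_one R_pos]) (simp add: L_def)
  also have "\<dots> \<le> ennreal y"
    unfolding L_def a_def c_def
    by (intro ennreal_leI sum_clamp_le[OF fin(2) y] less_le_trans[OF zero_less_one R_pos] R_mono)
  finally show ?thesis by (simp add: y_def)
qed

section \<open>Measurability of counts and shares\<close>

lemma borel_measurable_bh_count:
  assumes \<alpha>: "0 \<le> \<alpha>" and [measurable]: "\<And>j. j \<in> {1..m} \<Longrightarrow> (\<lambda>x. p x j) \<in> borel_measurable Q"
  shows "(\<lambda>x. real (bh_count \<alpha> m (p x))) \<in> borel_measurable Q"
proof -
  define c where "c k x = (\<Sum>j=1..m. of_bool (p x j \<le> \<alpha> / real m * real k) :: real)" for k x
  have c: "c k x = real (card {j\<in>{1..m}. p x j \<le> \<alpha> / real m * real k})" for k x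
    by (simp add: c_def of_bool_def sum.If_cases Int_def)
  have [measurable]: "c k \<in> borel_measurable Q" for k
    unfolding c_def by measurable
  \<comment> \<open>The count is the number of \<open>k\<close> in \<open>{1..m}\<close> that do not
    exceed it, and this holds for \<open>k\<close> exactly when some candidate \<open>l\<close> is
    at least \<open>k\<close>. That removes \<open>GREATEST\<close> in favour of finitely many
    comparisons.\<close>
  have "real (bh_count \<alpha> m (p x)) = (\<Sum>k=1..m. of_bool (\<exists>l\<in>{k..m}. real l \<le> c l x))" for x
  proof -
    have "(\<exists>l\<in>{k..m}. real l \<le> c l x) \<longleftrightarrow> k \<le> bh_count \<alpha> m (p x)" for k
    proof
      assume "\<exists>l\<in>{k..m}. real l \<le> c l x"
      then obtain l where "k \<le> l" "l \<le> card {j\<in>{1..m}. p x j \<le> \<alpha> / real m * real l}"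
        unfolding c by auto
      then show "k \<le> bh_count \<alpha> m (p x)" using le_bh_count le_trans by blast
    next
      assume "k \<le> bh_count \<alpha> m (p x)"
      then show "\<exists>l\<in>{k..m}. real l \<le> c l x"
        using bh_count_le[OF \<alpha>, of m "p x"] card_bh_count[OF \<alpha>, of m "p x"]
        by (intro bexI[of _ "bh_count \<alpha> m (p x)"]) (simp_all add: c)
    qed
    moreover have "{1..m} \<inter> {k. k \<le> bh_count \<alpha> m (p x)} = {1..bh_count \<alpha> m (p x)}"
      using bh_count_le[OF \<alpha>, of m "p x"] by auto
    ultimately show ?thesis by (simp add: of_bool_def sum.If_cases)
  qed
  then show ?thesis by (simp only:) measurable
qed

lemma borel_measurable_miscoverage_share:
  assumes \<alpha>: "0 \<le> \<alpha>" and j: "j \<in> {1..m}"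
    and b: "\<And>i. i \<in> {1..n + m} \<Longrightarrow> Measurable.pred Q (\<lambda>x. b x i)"
    and s: "\<And>i. i \<in> {1..n + m} \<Longrightarrow> (\<lambda>x. s x i) \<in> borel_measurable Q"
    and u: "\<And>l. l \<in> {1..m} \<Longrightarrow> (\<lambda>x. u x l) \<in> borel_measurable Q"
  shows "(\<lambda>x. miscoverage_share \<alpha> n m j (b x) (s x) (u x)) \<in> borel_measurable Q"
proof -
  have p: "(\<lambda>x. pval n (b x) (s x) (u x) l) \<in> borel_measurable Q" if l: "l \<in> {1..m}" for l
  proof -
    have [measurable]: "(\<lambda>x. u x l) \<in> borel_measurable Q" "(\<lambda>x. s x (n + l)) \<in> borel_measurable Q"
      using l by (auto intro: u s)
    have [measurable]: "Measurable.pred Q (\<lambda>x. b x i)" "(\<lambda>x. s x i) \<in> borel_measurable Q"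
      if "i \<in> {1..n}" for i
      using that by (auto intro!: b s)
    show ?thesis unfolding pval_def by measurable
  qed
  define B where "B x = b x (n + j)" for x
  define P where "P x = pval n (b x) (s x) (u x) j" for x
  define K where "K x = real (bh_count \<alpha> m (pval n (b x) (s x) (u x)))" for x
  have [measurable]: "Measurable.pred Q B" "P \<in> borel_measurable Q" "K \<in> borel_measurable Q"
    using b[of "n + j"] p[OF j] borel_measurable_bh_count[OF \<alpha> p] j
    unfolding B_def P_def K_def by simp_all
  have "miscoverage_share \<alpha> n m j (b x) (s x) (u x)
      = of_bool (B x \<and> P x \<le> \<alpha> / real m * K x) / max 1 (K x)" for x
    by (simp add: miscoverage_share_def B_def P_def K_def of_nat_max)
  then show ?thesis by simp
qed

section \<open>Permuting the data jointly with auxiliary data\<close>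

lemma sample_measurable:
  assumes "\<And>i. i \<in> {1..N} \<Longrightarrow> Z i \<in> M \<rightarrow>\<^sub>M S"
  shows "sample N Z \<in> M \<rightarrow>\<^sub>M data_space N S"
  using assms unfolding sample_def by (intro measurable_restrict)

text \<open>Outside \<open>{1..N}\<close> the permutation is the identity and both sides are
  \<open>undefined\<close>.\<close>

lemma sample_permute:
  assumes "\<sigma> permutes {1..N}"
  shows "sample N (\<lambda>i. Z (\<sigma> i)) \<omega> = sample N Z \<omega> \<circ> \<sigma>"
  using permutes_in_image[OF assms] permutes_not_in[OF assms]
  by (force simp: sample_def fun_eq_iff restrict_def)

lemma comp_permutes_measurable:
  assumes "\<sigma> permutes {1..N}"
  shows "(\<lambda>z. z \<circ> \<sigma>) \<in> data_space N S \<rightarrow>\<^sub>M data_space N S"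
proof (rule measurable_PiM_single')
  fix i assume "i \<in> {1..N}"
  then have "\<sigma> i \<in> {1..N}" using permutes_in_image[OF assms] by simp
  then show "(\<lambda>z. (z \<circ> \<sigma>) i) \<in> data_space N S \<rightarrow>\<^sub>M S"
    unfolding comp_def by (rule measurable_component_singleton)
next
  show "(\<lambda>z. z \<circ> \<sigma>) \<in> space (data_space N S) \<rightarrow> {1..N} \<rightarrow>\<^sub>E space S"
    using permutes_in_image[OF assms] permutes_not_in[OF assms]
    by (fastforce simp: space_PiM PiE_iff extensional_def)
qed

text \<open>Integrating the conditional probabilities over the event that \<open>D\<close> lies in
  \<open>B\<close> gives the joint probabilities. One event \<open>A\<close> is treated at a time,
  so a null set depending on \<open>A\<close> does no harm.\<close>

lemma (in prob_space) exchangeable_given_imp_measure_eq: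
  assumes Z: "\<And>i. i \<in> {1..N} \<Longrightarrow> Z i \<in> M \<rightarrow>\<^sub>M S" and D: "D \<in> M \<rightarrow>\<^sub>M MD"
    and ex: "exchangeable_given M S N Z MD D" and \<sigma>: "\<sigma> permutes {1..N}"
    and A: "A \<in> sets (data_space N S)" and B: "B \<in> sets MD"
  shows "emeasure M (sample N (\<lambda>i. Z (\<sigma> i)) -` A \<inter> D -` B \<inter> space M)
       = emeasure M (sample N Z -` A \<inter> D -` B \<inter> space M)"
proof -
  let ?F = "vimage_algebra (space M) D MD"
  have sub: "subalgebra M ?F"
    using D by (auto simp: subalgebra_def sets_vimage_algebra2 measurable_space measurable_sets)
  interpret finite_measure_subalgebra M ?F by unfold_locales (rule sub)
  have E: "D -` B \<inter> space M \<in> sets ?F" by (rule in_vimage_algebra[OF B])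
  have "measure M (W -` A \<inter> D -` B \<inter> space M)
      = (\<integral>x\<in>D -` B \<inter> space M. prob_given M MD D (W -` A \<inter> space M) x \<partial>M)"
    if W: "W \<in> M \<rightarrow>\<^sub>M data_space N S" for W
  proof -
    have WA: "W -` A \<inter> space M \<in> sets M" using W A by (rule measurable_sets)
    have DB: "D -` B \<inter> space M \<in> sets M" using D B by (rule measurable_sets)
    have "(\<integral>x\<in>D -` B \<inter> space M. indicator (W -` A \<inter> space M) x \<partial>M)
      = (\<integral>x\<in>D -` B \<inter> space M. prob_given M MD D (W -` A \<inter> space M) x \<partial>M)"
      unfolding prob_given_def
      by (rule real_cond_exp_intA[OF _ E]) (simp add: WA emeasure_eq_measure)
    moreover have "(\<integral>x\<in>D -` B \<inter> space M. indicator (W -` A \<inter> space M) x \<partial>M)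
      = (\<integral>x. indicator (W -` A \<inter> D -` B \<inter> space M) x \<partial>M :: real)"
      unfolding set_lebesgue_integral_def by (rule Bochner_Integration.integral_cong) (auto simp: indicator_def)
    ultimately show ?thesis by (simp add: Int_absorb2)
  qed
  note * = this
  have Z\<sigma>: "Z (\<sigma> i) \<in> M \<rightarrow>\<^sub>M S" if "i \<in> {1..N}" for i
    using that permutes_in_image[OF \<sigma>] by (intro Z) simp
  have mZ: "sample N Z \<in> M \<rightarrow>\<^sub>M data_space N S" by (rule sample_measurable) (rule Z)
  have mZ\<sigma>: "sample N (\<lambda>i. Z (\<sigma> i)) \<in> M \<rightarrow>\<^sub>M data_space N S" by (rule sample_measurable) (rule Z\<sigma>)
  have "AE \<omega> in M. prob_given M MD D (sample N (\<lambda>i. Z (\<sigma> i)) -` A \<inter> space M) \<omega> =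
        prob_given M MD D (sample N Z -` A \<inter> space M) \<omega>"
    using ex \<sigma> A unfolding exchangeable_given_def by blast
  then have "(\<integral>x\<in>D -` B \<inter> space M. prob_given M MD D (sample N (\<lambda>i. Z (\<sigma> i)) -` A \<inter> space M) x \<partial>M)
     = (\<integral>x\<in>D -` B \<inter> space M. prob_given M MD D (sample N Z -` A \<inter> space M) x \<partial>M)"
    unfolding set_lebesgue_integral_def prob_given_def
    by (intro integral_cong_AE) (use E sub in \<open>auto intro!: borel_measurable_scaleR borel_measurable_indicator simp: subalgebra_def\<close>)
  then show ?thesis
    using *[OF mZ] *[OF mZ\<sigma>] by (simp add: emeasure_eq_measure)
qed

text \<open>Take the whole space for \<open>B\<close>. This supplies the premise of the second
  clause of \<open>permutation_invariant\<close>.\<close>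

lemma (in prob_space) exchangeable_given_imp_exchangeable:
  assumes Z: "\<And>i. i \<in> {1..N} \<Longrightarrow> Z i \<in> M \<rightarrow>\<^sub>M S" and D: "D \<in> M \<rightarrow>\<^sub>M MD"
    and ex: "exchangeable_given M S N Z MD D"
  shows "exchangeable M S N Z"
  unfolding exchangeable_def
proof (intro allI impI)
  fix \<sigma> assume \<sigma>: "\<sigma> permutes {1..N}"
  have Z\<sigma>: "Z (\<sigma> i) \<in> M \<rightarrow>\<^sub>M S" if "i \<in> {1..N}" for i
    using that permutes_in_image[OF \<sigma>] by (intro Z) simp
  have mZ: "sample N Z \<in> M \<rightarrow>\<^sub>M data_space N S" by (rule sample_measurable) (rule Z)
  have mZ\<sigma>: "sample N (\<lambda>i. Z (\<sigma> i)) \<in> M \<rightarrow>\<^sub>M data_space N S" by (rule sample_measurable) (rule Z\<sigma>)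
  show "distr M (data_space N S) (sample N (\<lambda>i. Z (\<sigma> i))) = distr M (data_space N S) (sample N Z)"
  proof (rule measure_eqI)
    fix A assume "A \<in> sets (distr M (data_space N S) (sample N (\<lambda>i. Z (\<sigma> i))))"
    then have A: "A \<in> sets (data_space N S)" by simp
    have "W \<inter> D -` space MD \<inter> space M = W \<inter> space M" for W
      using measurable_space[OF D] by auto
    then show "emeasure (distr M (data_space N S) (sample N (\<lambda>i. Z (\<sigma> i)))) A
        = emeasure (distr M (data_space N S) (sample N Z)) A"
      using exchangeable_given_imp_measure_eq[OF Z D ex \<sigma> A sets.top]
      by (simp add: emeasure_distr[OF mZ A]
          emeasure_distr[OF mZ\<sigma> A] del: One_nat_def)
  qed simp
qed

text \<open>Measurable rectangles form an intersection-stable generator, and on them the two laws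
  agree by the integrated form of conditional exchangeability.\<close>

lemma (in prob_space) distr_permute_eq:
  assumes Z: "\<And>i. i \<in> {1..N} \<Longrightarrow> Z i \<in> M \<rightarrow>\<^sub>M S" and D: "D \<in> M \<rightarrow>\<^sub>M MD"
    and ex: "exchangeable_given M S N Z MD D" and \<sigma>: "\<sigma> permutes {1..N}"
  shows "distr M (data_space N S \<Otimes>\<^sub>M MD) (\<lambda>\<omega>. (sample N Z \<omega> \<circ> \<sigma>, D \<omega>))
       = distr M (data_space N S \<Otimes>\<^sub>M MD) (\<lambda>\<omega>. (sample N Z \<omega>, D \<omega>))"
proof -
  let ?E = "{a \<times> b | a b. a \<in> sets (data_space N S) \<and> b \<in> sets MD}"
  let ?\<Omega> = "space (data_space N S) \<times> space MD"
  have Z\<sigma>: "Z (\<sigma> i) \<in> M \<rightarrow>\<^sub>M S" if "i \<in> {1..N}" for i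
    using that permutes_in_image[OF \<sigma>] by (intro Z) simp
  have mZ: "sample N Z \<in> M \<rightarrow>\<^sub>M data_space N S" by (rule sample_measurable) (rule Z)
  have mZ\<sigma>: "sample N (\<lambda>i. Z (\<sigma> i)) \<in> M \<rightarrow>\<^sub>M data_space N S" by (rule sample_measurable) (rule Z\<sigma>)
  note [measurable] = D
  have emeasure_rect: "emeasure (distr M (data_space N S \<Otimes>\<^sub>M MD) (\<lambda>\<omega>. (W \<omega>, D \<omega>))) (A \<times> B)
      = emeasure M (W -` A \<inter> D -` B \<inter> space M)"
    if [measurable]: "W \<in> M \<rightarrow>\<^sub>M data_space N S" "A \<in> sets (data_space N S)" "B \<in> sets MD" for W A B
    by (subst emeasure_distr, measurable) (auto intro!: arg_cong[where f="emeasure M"])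
  show ?thesis unfolding sample_permute[OF \<sigma>, symmetric]
  proof (rule measure_eqI_generator_eq[OF Int_stable_pair_measure_generator pair_measure_closed])
    fix X assume "X \<in> ?E"
    then obtain A B where "X = A \<times> B" and AB: "A \<in> sets (data_space N S)" "B \<in> sets MD" by auto
    then show "emeasure (distr M (data_space N S \<Otimes>\<^sub>M MD) (\<lambda>\<omega>. (sample N (\<lambda>i. Z (\<sigma> i)) \<omega>, D \<omega>))) X
       = emeasure (distr M (data_space N S \<Otimes>\<^sub>M MD) (\<lambda>\<omega>. (sample N Z \<omega>, D \<omega>))) X"
      using exchangeable_given_imp_measure_eq[OF Z D ex \<sigma> AB]
        emeasure_rect[OF mZ AB] emeasure_rect[OF mZ\<sigma> AB]
      by simp
  next
    show "range (\<lambda>_::nat. ?\<Omega>) \<subseteq> ?E" by auto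
    show "emeasure (distr M (data_space N S \<Otimes>\<^sub>M MD) (\<lambda>\<omega>. (sample N (\<lambda>i. Z (\<sigma> i)) \<omega>, D \<omega>))) ?\<Omega> \<noteq> \<infinity>"
      unfolding emeasure_rect[OF mZ\<sigma> sets.top sets.top] by (simp add: emeasure_eq_measure)
  qed (simp_all add: sets_pair_measure)
qed

section \<open>Averaging over the swaps\<close>

lemma bh_count_cong:
  assumes "\<And>l. l \<in> {1..m} \<Longrightarrow> p l = q l"
  shows "bh_count \<alpha> m p = bh_count \<alpha> m q"
proof -
  have "{j\<in>{1..m}. p j \<le> a} = {j\<in>{1..m}. q j \<le> a}" for a using assms by auto
  then show ?thesis unfolding bh_count_def by simp
qed

text \<open>Allows \<open>sample m U\<close> to replace \<open>U\<close>, and swapped data to be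
  compared with the original, where agreement is known only on the index ranges.\<close>

lemma miscoverage_share_cong:
  assumes j: "j \<in> {1..m}"
    and eq: "\<And>i. i \<in> {1..n + m} \<Longrightarrow> b i = b' i" "\<And>i. i \<in> {1..n + m} \<Longrightarrow> s i = s' i"
      "\<And>l. l \<in> {1..m} \<Longrightarrow> u l = u' l"
  shows "miscoverage_share \<alpha> n m j b s u = miscoverage_share \<alpha> n m j b' s' u'"
proof -
  have p: "pval n b s u l = pval n b' s' u' l" if "l \<in> {1..m}" for l
    using that eq(1,2) eq(3)[OF that] by (simp add: pval_def cong: sum.cong_simp)
  have "bh_count \<alpha> m (pval n b s u) = bh_count \<alpha> m (pval n b' s' u')"
    by (rule bh_count_cong) (rule p)
  then show ?thesis
    using j eq(1)[of "n + j"] p[OF j] by (simp add: miscoverage_share_def)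
qed

text \<open>Here \<open>W\<close> stands for data with auxiliary data and \<open>g i\<close> for the
  swap of points \<open>i\<close> and \<open>n + j\<close>. As the law of \<open>W\<close> is
  invariant under every \<open>g i\<close>, the expected share equals its average over the
  \<open>n + 1\<close> swaps, and that average is bounded for each fixed value of
  \<open>W\<close>.\<close>

lemma (in prob_space) nn_integral_miscoverage_share_le:
  fixes E :: "'e measure" and b :: "'e \<Rightarrow> nat \<Rightarrow> bool" and s :: "'e \<Rightarrow> nat \<Rightarrow> real"
  defines "V \<equiv> uniform_measure lborel {0<..<1::real}"
  assumes \<alpha>: "0 \<le> \<alpha>" and j: "j \<in> {1..m}"
    and mU: "sample m U \<in> M \<rightarrow>\<^sub>M PiM {1..m} (\<lambda>_. borel)" and mW [measurable]: "W \<in> M \<rightarrow>\<^sub>M E"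
    and joint: "distr M (PiM {1..m} (\<lambda>_. borel) \<Otimes>\<^sub>M E) (\<lambda>\<omega>. (sample m U \<omega>, W \<omega>))
        = PiM {1..m} (\<lambda>_. V) \<Otimes>\<^sub>M distr M E W"
    and b: "\<And>i. i \<in> {1..n + m} \<Longrightarrow> Measurable.pred E (\<lambda>e. b e i)"
    and s: "\<And>i. i \<in> {1..n + m} \<Longrightarrow> (\<lambda>e. s e i) \<in> borel_measurable E"
    and g: "\<And>i. i \<in> insert (n + j) {1..n} \<Longrightarrow> g i \<in> E \<rightarrow>\<^sub>M E"
    and inv: "\<And>i. i \<in> insert (n + j) {1..n} \<Longrightarrow> distr M E (\<lambda>\<omega>. g i (W \<omega>)) = distr M E W"
    and b_g: "\<And>i k e. i \<in> insert (n + j) {1..n} \<Longrightarrow> k \<in> {1..n + m} \<Longrightarrow> e \<in> space E \<Longrightarrow>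
        b (g i e) k = b e (Transposition.transpose i (n + j) k)"
    and s_g: "\<And>i k e. i \<in> insert (n + j) {1..n} \<Longrightarrow> k \<in> {1..n + m} \<Longrightarrow> e \<in> space E \<Longrightarrow>
        s (g i e) k = s e (Transposition.transpose i (n + j) k)"
  shows "(\<integral>\<^sup>+ \<omega>. ennreal (miscoverage_share \<alpha> n m j (b (W \<omega>)) (s (W \<omega>)) (\<lambda>l. U l \<omega>)) \<partial>M)
           \<le> ennreal (\<alpha> / real m)"
proof -
  let ?I = "insert (n + j) {1..n}" and ?\<tau> = "\<lambda>i. Transposition.transpose i (n + j)"
  let ?B = "PiM {1..m} (\<lambda>_. borel :: real measure)" and ?P = "PiM {1..m} (\<lambda>_. V)"
  define Q where "Q = distr M E W"
  define F where "F e u = ennreal (miscoverage_share \<alpha> n m j (b e) (s e) u)" for e u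
  define H where "H e = (\<integral>\<^sup>+ u. F e u \<partial>?P)" for e
  have V: "prob_space V"
    unfolding V_def by (intro prob_space_uniform_measure) auto
  have sets_V [measurable_cong]: "sets V = sets borel" by (simp add: V_def)
  interpret V: product_prob_space "\<lambda>_::nat. V" "{1..m}"
    using V by (intro product_prob_spaceI)
  have P: "prob_space ?P" using V by (intro prob_space_PiM)
  interpret Q: prob_space Q unfolding Q_def by (rule prob_space_distr[OF mW])
  interpret PQ: pair_sigma_finite ?P Q
    using P Q.prob_space_axioms by (intro pair_sigma_finite.intro prob_space_imp_sigma_finite)
  have sets_P [measurable_cong]: "sets ?P = sets ?B" by (intro sets_PiM_cong) (simp_all add: sets_V)
  have sets_Q [measurable_cong]: "sets Q = sets E" by (simp add: Q_def)
  have F_meas: "(\<lambda>(u, e). F e u) \<in> borel_measurable (?B \<Otimes>\<^sub>M E)"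
    unfolding F_def case_prod_beta
  proof (intro measurable_compose[OF _ measurable_ennreal] borel_measurable_miscoverage_share \<alpha> j)
    fix i assume i: "i \<in> {1..n + m}"
    show "Measurable.pred (?B \<Otimes>\<^sub>M E) (\<lambda>x. b (snd x) i)"
      by (rule measurable_compose[OF measurable_snd b[OF i]])
    show "(\<lambda>x. s (snd x) i) \<in> borel_measurable (?B \<Otimes>\<^sub>M E)"
      by (rule measurable_compose[OF measurable_snd s[OF i]])
  next
    fix l assume l: "l \<in> {1..m}"
    show "(\<lambda>x. fst x l) \<in> borel_measurable (?B \<Otimes>\<^sub>M E)"
      by (rule measurable_compose[OF measurable_fst measurable_component_singleton[OF l]])
  qed
  have F_meas': "(\<lambda>(u, e). F e u) \<in> borel_measurable (?P \<Otimes>\<^sub>M Q)"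
    using F_meas measurable_cong_sets[OF sets_pair_measure_cong[OF sets_P sets_Q] refl] by blast
  have H_meas: "H \<in> borel_measurable E"
  proof -
    have "(\<lambda>(e, u). F e u) \<in> borel_measurable (E \<Otimes>\<^sub>M ?B)"
      using measurable_compose[OF measurable_pair_swap' F_meas] by (simp add: case_prod_beta)
    then have "(\<lambda>(e, u). F e u) \<in> borel_measurable (E \<Otimes>\<^sub>M ?P)"
      using measurable_cong_sets[OF sets_pair_measure_cong[OF refl sets_P] refl] by blast
    then show ?thesis unfolding H_def by (rule sigma_finite_measure.borel_measurable_nn_integral[OF prob_space_imp_sigma_finite[OF P]])
  qed
  have "(\<integral>\<^sup>+ \<omega>. ennreal (miscoverage_share \<alpha> n m j (b (W \<omega>)) (s (W \<omega>)) (\<lambda>l. U l \<omega>)) \<partial>M)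
      = (\<integral>\<^sup>+ \<omega>. (\<lambda>(u, e). F e u) (sample m U \<omega>, W \<omega>) \<partial>M)"
    unfolding F_def case_prod_conv
    by (intro nn_integral_cong arg_cong[where f=ennreal] miscoverage_share_cong j) (simp_all add: sample_def)
  also have "\<dots> = (\<integral>\<^sup>+ x. (\<lambda>(u, e). F e u) x \<partial>distr M (?B \<Otimes>\<^sub>M E) (\<lambda>\<omega>. (sample m U \<omega>, W \<omega>)))"
    by (rule nn_integral_distr[symmetric]) (simp_all add: mU mW F_meas measurable_Pair del: One_nat_def)
  \<comment> \<open>The joint law is a product, so the uniform variables can be integrated out first
    for fixed data.\<close>
  also have "distr M (?B \<Otimes>\<^sub>M E) (\<lambda>\<omega>. (sample m U \<omega>, W \<omega>)) = ?P \<Otimes>\<^sub>M Q"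
    unfolding joint Q_def ..
  also have "(\<integral>\<^sup>+ x. (\<lambda>(u, e). F e u) x \<partial>(?P \<Otimes>\<^sub>M Q)) = (\<integral>\<^sup>+ e. H e \<partial>Q)"
    unfolding H_def using PQ.nn_integral_snd[OF F_meas'] by simp
  finally have eq: "(\<integral>\<^sup>+ \<omega>. ennreal (miscoverage_share \<alpha> n m j (b (W \<omega>)) (s (W \<omega>)) (\<lambda>l. U l \<omega>)) \<partial>M)
      = (\<integral>\<^sup>+ e. H e \<partial>Q)" .
  have H_g: "(\<integral>\<^sup>+ e. H (g i e) \<partial>Q) = (\<integral>\<^sup>+ e. H e \<partial>Q)" if i: "i \<in> ?I" for i
  proof -
    have "(\<integral>\<^sup>+ e. H (g i e) \<partial>Q) = (\<integral>\<^sup>+ \<omega>. H (g i (W \<omega>)) \<partial>M)"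
      unfolding Q_def using measurable_compose[OF g[OF i] H_meas] mW by (simp add: nn_integral_distr)
    also have "\<dots> = (\<integral>\<^sup>+ e. H e \<partial>distr M E (\<lambda>\<omega>. g i (W \<omega>)))"
      using measurable_compose[OF mW g[OF i]] H_meas by (simp add: nn_integral_distr)
    finally show ?thesis by (simp add: inv[OF i] Q_def)
  qed
  have sum_le: "(\<Sum>i\<in>?I. H (g i e)) \<le> ennreal (\<alpha> * (real n + 1) / real m)" if e: "e \<in> space E" for e
  proof -
    define f where "f i u = ennreal (miscoverage_share \<alpha> n m j (b e \<circ> ?\<tau> i) (s e \<circ> ?\<tau> i) u)" for i u
    have f_eq: "F (g i e) u = f i u" if "i \<in> ?I" for i u
      unfolding F_def f_def
      using b_g[OF that _ e] s_g[OF that _ e] by (intro arg_cong[where f=ennreal] miscoverage_share_cong j) auto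
    have f_meas: "f i \<in> borel_measurable ?P" for i
      unfolding f_def
      by (intro measurable_compose[OF _ measurable_ennreal] borel_measurable_miscoverage_share \<alpha> j)
        (simp_all add: measurable_component_singleton[of _ _ "\<lambda>_. V", simplified measurable_cong_sets[OF refl sets_V]] del: One_nat_def)
    have f_meas_upd: "(\<lambda>t. f i (u(j := t))) \<in> borel_measurable V" for i u
      unfolding f_def
      by (intro measurable_compose[OF _ measurable_ennreal] borel_measurable_miscoverage_share \<alpha> j) auto
    have I: "insert j ({1..m} - {j}) = {1..m}" using j by auto
    have "(\<Sum>i\<in>?I. H (g i e)) = (\<Sum>i\<in>?I. \<integral>\<^sup>+ u. f i u \<partial>?P)"
      unfolding H_def by (intro sum.cong nn_integral_cong refl f_eq)
    also have "\<dots> = (\<integral>\<^sup>+ u. (\<Sum>i\<in>?I. f i u) \<partial>?P)"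
      by (intro nn_integral_sum[symmetric] f_meas)
    \<comment> \<open>Coordinate \<open>j\<close> is split off: the inner integral over it is the
      one bounded with the other uniform variables fixed.\<close>
    also have "\<dots> = (\<integral>\<^sup>+ u. \<integral>\<^sup>+ t. (\<Sum>i\<in>?I. f i (u(j := t))) \<partial>V \<partial>PiM ({1..m} - {j}) (\<lambda>_. V))"
      using V.product_nn_integral_insert[of "{1..m} - {j}" j "\<lambda>u. \<Sum>i\<in>?I. f i u"] f_meas
      unfolding I by (simp add: borel_measurable_sum del: One_nat_def)
    also have "\<dots> \<le> (\<integral>\<^sup>+ u. ennreal (\<alpha> * (real n + 1) / real m) \<partial>PiM ({1..m} - {j}) (\<lambda>_. V))"
    \<comment> \<open>The fixed-data bound requires the other uniform variables to lie in the unit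
      interval, which holds almost everywhere.\<close>
    proof (rule nn_integral_mono_AE)
      have "AE t in V. 0 \<le> t \<and> t \<le> 1"
        unfolding V_def by (rule AE_uniform_measureI) auto
      then have "AE u in PiM ({1..m} - {j}) (\<lambda>_. V). \<forall>l\<in>{1..m} - {j}. 0 \<le> u l \<and> u l \<le> 1"
        using V by (intro AE_finite_allI AE_PiM_component) auto
      then show "AE u in PiM ({1..m} - {j}) (\<lambda>_. V).
          (\<integral>\<^sup>+ t. (\<Sum>i\<in>?I. f i (u(j := t))) \<partial>V) \<le> ennreal (\<alpha> * (real n + 1) / real m)"
      proof eventually_elim
        fix u :: "nat \<Rightarrow> real" assume "\<forall>l\<in>{1..m} - {j}. 0 \<le> u l \<and> u l \<le> 1"
        then have "(\<Sum>i\<in>?I. \<integral>\<^sup>+ t. f i (u(j := t)) \<partial>V) \<le> ennreal (\<alpha> * (real n + 1) / real m)"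
          unfolding f_def V_def by (intro sum_miscoverage_share_le \<alpha> j) blast
        then show "(\<integral>\<^sup>+ t. (\<Sum>i\<in>?I. f i (u(j := t))) \<partial>V) \<le> ennreal (\<alpha> * (real n + 1) / real m)"
          by (simp only: nn_integral_sum[OF f_meas_upd])
      qed
    qed
    also have "\<dots> = ennreal (\<alpha> * (real n + 1) / real m)"
      using prob_space.emeasure_space_1[OF prob_space_PiM[of "{1..m} - {j}" "\<lambda>_. V"]] V by simp
    finally show ?thesis .
  qed
  \<comment> \<open>All \<open>n + 1\<close> swaps give the same integral; the finite positive
    factor \<open>n + 1\<close> is cancelled at the end.\<close>
  have "ennreal (real n + 1) * (\<integral>\<^sup>+ e. H e \<partial>Q) = (\<Sum>i\<in>?I. \<integral>\<^sup>+ e. H (g i e) \<partial>Q)"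
    using j H_g by (simp add: ennreal_of_nat_eq_real_of_nat add.commute)
  also have "\<dots> = (\<integral>\<^sup>+ e. (\<Sum>i\<in>?I. H (g i e)) \<partial>Q)"
    using measurable_compose[OF g H_meas] measurable_cong_sets[OF sets_Q refl]
    by (intro nn_integral_sum[symmetric]) blast
  also have "\<dots> \<le> (\<integral>\<^sup>+ e. ennreal (\<alpha> * (real n + 1) / real m) \<partial>Q)"
    using sum_le by (intro nn_integral_mono) (simp add: Q_def)
  also have "\<dots> = ennreal (real n + 1) * ennreal (\<alpha> / real m)"
    using \<alpha> by (subst ennreal_mult[symmetric]) (simp_all add: Q.emeasure_space_1 mult.commute)
  finally show ?thesis
    unfolding eq by (subst (asm) ennreal_mult_le_mult_iff) auto
qed

section \<open>From single test points to the false coverage rate\<close>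

theorem theorem3:
  fixes M :: "'w measure" and MX :: "'x measure" and MY :: "'y measure"
    and MD :: "'d measure" and MDtr :: "'t measure"
    and n m :: nat and \<alpha> :: real
    and Z :: "nat \<Rightarrow> 'w \<Rightarrow> 'x \<times> 'y" and D :: "'w \<Rightarrow> 'd" and Dtr :: "'w \<Rightarrow> 't"
    and U :: "nat \<Rightarrow> 'w \<Rightarrow> real"
    and \<I> :: "'y set set"
    and C :: "(nat \<Rightarrow> 'x \<times> 'y) \<Rightarrow> 'd \<Rightarrow> 'x \<Rightarrow> 'y set"
    and T :: "(nat \<Rightarrow> 'x \<times> 'y) \<Rightarrow> 'd \<Rightarrow> 'x \<Rightarrow> 'y set \<Rightarrow> real"
  defines "S \<equiv> MX \<Otimes>\<^sub>M MY"
    and "N \<equiv> n + m"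
  assumes prob: "prob_space M"
    and n: "1 \<le> n" and m: "1 \<le> m" and \<alpha>: "0 < \<alpha>" "\<alpha> < 1"
    \<comment> \<open>the data, the auxiliary data and the training data\<close>
    and Z: "\<And>i. i \<in> {1..N} \<Longrightarrow> Z i \<in> M \<rightarrow>\<^sub>M S"
    and D: "D \<in> M \<rightarrow>\<^sub>M MD" and Dtr: "Dtr \<in> M \<rightarrow>\<^sub>M MDtr"
    \<comment> \<open>informative sets, informative set constructor and trust score\<close>
    and \<I>: "\<And>A. A \<in> \<I> \<Longrightarrow> A \<subseteq> space MY"
    and C: "\<And>z d x. z \<in> space (data_space N S) \<Longrightarrow> d \<in> space MD \<Longrightarrow> x \<in> space MX \<Longrightarrow> C z d x \<in> \<I>"
    and T: "\<And>z d x A. z \<in> space (data_space N S) \<Longrightarrow> d \<in> space MD \<Longrightarrow> x \<in> space MX \<Longrightarrow> A \<in> \<I> \<Longrightarrow>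
              0 < T z d x A"
    \<comment> \<open>coverage events and trust scores are measurable functions of data and auxiliary data\<close>
    and C_meas: "\<And>i. i \<in> {1..N} \<Longrightarrow>
              Measurable.pred (data_space N S \<Otimes>\<^sub>M MD) (\<lambda>(z, d). covered z (C z d) i)"
    and T_meas: "\<And>i. i \<in> {1..N} \<Longrightarrow>
              (\<lambda>(z, d). trust z (C z d) (T z d) i) \<in> borel_measurable (data_space N S \<Otimes>\<^sub>M MD)"
    \<comment> \<open>i.i.d. uniform variables, independent of everything else\<close>
    and U_indep: "prob_space.indep_vars M (\<lambda>_. borel) U {1..m}"
    and U_unif: "\<And>j. j \<in> {1..m} \<Longrightarrow> distr M lborel (U j) = uniform_measure lborel {0<..<1}"
    and U_indep_data: "prob_space.indep_set M
              (sets (vimage_algebra (space M) (sample m U) (PiM {1..m} (\<lambda>_. borel))))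
              (sets (vimage_algebra (space M) (\<lambda>\<omega>. (sample N Z \<omega>, D \<omega>, Dtr \<omega>))
                 (data_space N S \<Otimes>\<^sub>M (MD \<Otimes>\<^sub>M MDtr))))"
    and exch: "exchangeable_given M S N Z MDtr Dtr"
    and C_inv: "permutation_invariant M S N Z MD D (space MX) C"
    and T_inv: "permutation_invariant M S N Z MD D (space MX) (\<lambda>z d x. T z d x (C z d x))"
  shows "FCR M n m \<alpha> Z D C T U \<le> \<alpha>"
proof -
  let ?E = "data_space N S \<Otimes>\<^sub>M MD" and ?B = "PiM {1..m} (\<lambda>_. borel :: real measure)"
  let ?V = "uniform_measure lborel {0<..<1::real}"
  define W where "W \<omega> = (sample N Z \<omega>, D \<omega>)" for \<omega>
  define b where "b = (\<lambda>(z, d) i. \<not> covered z (C z d) i)"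
  define s where "s = (\<lambda>(z, d). trust z (C z d) (T z d))"
  interpret prob_space M by (rule prob)
  have mZ [measurable]: "sample N Z \<in> M \<rightarrow>\<^sub>M data_space N S"
    by (rule sample_measurable) (rule Z)
  note [measurable] = D Dtr
  have mW [measurable]: "W \<in> M \<rightarrow>\<^sub>M ?E"
    unfolding W_def by measurable
  have U_meas: "U j \<in> borel_measurable M" if "j \<in> {1..m}" for j
    using U_indep that by (auto simp: indep_vars_def)
  have mU: "sample m U \<in> M \<rightarrow>\<^sub>M ?B"
    by (rule sample_measurable) (rule U_meas)
  \<comment> \<open>Exchangeability given the training data is passed on to \<open>D\<close> in two
    steps: first drop the conditioning, then use clause (b) of permutation invariance.\<close>
  have "exchangeable M S N Z"
    by (rule exchangeable_given_imp_exchangeable[OF _ Dtr exch]) (rule Z)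
  then have exch_D: "exchangeable_given M S N Z MD D"
    using C_inv by (simp add: permutation_invariant_def)
  have joint: "distr M (?B \<Otimes>\<^sub>M ?E) (\<lambda>\<omega>. (sample m U \<omega>, W \<omega>)) = PiM {1..m} (\<lambda>_. ?V) \<Otimes>\<^sub>M distr M ?E W"
  proof -
    have "distr M ?B (sample m U) = PiM {1..m} (\<lambda>i. distr M borel (U i))"
      using U_indep m U_meas indep_vars_iff_distr_eq_PiM'[where I = "{1..m}" and M' = "\<lambda>_. borel" and X = U]
      by (simp add: sample_def[abs_def])
    also have "\<dots> = PiM {1..m} (\<lambda>_. ?V)"
    proof (rule PiM_cong[OF refl])
      fix i assume "i \<in> {1..m}"
      from U_unif[OF this] show "distr M borel (U i) = ?V"
        using distr_cong[of M M borel lborel "U i" "U i"] by simp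
    qed
    finally have U_distr: "distr M ?B (sample m U) = PiM {1..m} (\<lambda>_. ?V)" .
    have "distr M ?B (sample m U) \<Otimes>\<^sub>M distr M ?E W = distr M (?B \<Otimes>\<^sub>M ?E) (\<lambda>\<omega>. (sample m U \<omega>, W \<omega>))"
    proof (rule pair_measure_eqI)
      show "sigma_finite_measure (distr M ?B (sample m U))" "sigma_finite_measure (distr M ?E W)"
        using mU mW by (simp_all add: prob_space_distr prob_space_imp_sigma_finite del: One_nat_def)
    next
      fix A B assume "A \<in> sets (distr M ?B (sample m U))" "B \<in> sets (distr M ?E W)"
      then have A: "A \<in> sets ?B" and B [measurable]: "B \<in> sets ?E" by simp_all
      let ?X = "\<lambda>\<omega>. (sample N Z \<omega>, D \<omega>, Dtr \<omega>)" and ?E' = "data_space N S \<Otimes>\<^sub>M (MD \<Otimes>\<^sub>M MDtr)"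
      \<comment> \<open>Independence is assumed for the triple that includes \<open>Dtr\<close>; an
        event about \<open>W\<close> is its pullback along the projection that forgets
        \<open>Dtr\<close>.\<close>
      have W_eq: "W -` B \<inter> space M = ?X -` ((\<lambda>(z, d, t). (z, d)) -` B \<inter> space ?E') \<inter> space M"
        using measurable_space[OF mZ] measurable_space[OF D] measurable_space[OF Dtr]
        by (auto simp: W_def space_pair_measure)
      have "(\<lambda>(z, d, t). (z, d)) -` B \<inter> space ?E' \<in> sets ?E'"
        by measurable
      then have "W -` B \<inter> space M \<in> sets (vimage_algebra (space M) ?X ?E')"
        unfolding W_eq by (rule in_vimage_algebra)
      with U_indep_data in_vimage_algebra[OF A, of "sample m U" "space M"] have "prob (sample m U -` A \<inter> space M \<inter> (W -` B \<inter> space M))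
          = prob (sample m U -` A \<inter> space M) * prob (W -` B \<inter> space M)"
        unfolding indep_sets2_eq by blast
      moreover have "(\<lambda>\<omega>. (sample m U \<omega>, W \<omega>)) -` (A \<times> B) \<inter> space M = sample m U -` A \<inter> space M \<inter> (W -` B \<inter> space M)"
        by auto
      ultimately show "emeasure (distr M ?B (sample m U)) A * emeasure (distr M ?E W) B
          = emeasure (distr M (?B \<Otimes>\<^sub>M ?E) (\<lambda>\<omega>. (sample m U \<omega>, W \<omega>))) (A \<times> B)"
        by (simp only: emeasure_distr[OF mU A] emeasure_distr[OF mW B]
            emeasure_distr[OF measurable_Pair[OF mU mW] pair_measureI[OF A B]] emeasure_eq_measure)
          (simp add: ennreal_mult)
    qed simp
    then show ?thesis by (simp only: U_distr)
  qed
  have b_meas: "Measurable.pred ?E (\<lambda>e. b e i)" if "i \<in> {1..n + m}" for i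
    using C_meas[of i] that by (simp add: b_def N_def case_prod_beta)
  have s_meas: "(\<lambda>e. s e i) \<in> borel_measurable ?E" if "i \<in> {1..n + m}" for i
    using T_meas[of i] that by (simp add: s_def N_def case_prod_beta)
  have share_le: "(\<integral>\<^sup>+ \<omega>. ennreal (miscoverage_share \<alpha> n m j (b (W \<omega>)) (s (W \<omega>)) (\<lambda>l. U l \<omega>)) \<partial>M)
      \<le> ennreal (\<alpha> / real m)" if j: "j \<in> {1..m}" for j
  \<comment> \<open>The swap moves data points and leaves the auxiliary data fixed, so its
    invariance is a statement about the joint law with \<open>D\<close>.\<close>
  proof (rule nn_integral_miscoverage_share_le[where E = ?E
        and g = "\<lambda>i (z, d). (z \<circ> Transposition.transpose i (n + j), d)", OF _ j mU mW joint b_meas s_meas])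
    fix i assume i: "i \<in> insert (n + j) {1..n}"
    let ?\<tau> = "Transposition.transpose i (n + j)"
    have \<tau>: "?\<tau> permutes {1..N}"
      using i j by (intro permutes_swap_id) (auto simp: N_def)
    note [measurable] = comp_permutes_measurable[OF \<tau>]
    show "(\<lambda>(z, d). (z \<circ> ?\<tau>, d)) \<in> ?E \<rightarrow>\<^sub>M ?E"
      by measurable
    show "distr M ?E (\<lambda>\<omega>. case W \<omega> of (z, d) \<Rightarrow> (z \<circ> ?\<tau>, d)) = distr M ?E W"
      using distr_permute_eq[OF _ D exch_D \<tau>] Z unfolding W_def by simp
    fix k e assume k: "k \<in> {1..n + m}" and e: "e \<in> space ?E"
    obtain z d where zd: "e = (z, d)" "z \<in> space (data_space N S)" "d \<in> space MD"
      using e by (auto simp: space_pair_measure)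
    have "?\<tau> k \<in> {1..N}" using k permutes_in_image[OF \<tau>] by (simp add: N_def)
    then have "z (?\<tau> k) \<in> space S"
      using zd(2) by (auto simp: space_PiM)
    then have x: "fst (z (?\<tau> k)) \<in> space MX"
      by (auto simp: S_def space_pair_measure)
    \<comment> \<open>The constructor ignores the order of the data, so the swap changes only the
      point at which it is evaluated. The same argument serves the trust score.\<close>
    have C_eq: "C (z \<circ> ?\<tau>) d (fst (z (?\<tau> k))) = C z d (fst (z (?\<tau> k)))"
      using C_inv zd \<tau> x unfolding permutation_invariant_def by metis
    show "b (case e of (z, d) \<Rightarrow> (z \<circ> ?\<tau>, d)) k = b e (?\<tau> k)"
      using C_eq by (simp add: zd(1) b_def covered_def)
    have "T (z \<circ> ?\<tau>) d (fst (z (?\<tau> k))) (C (z \<circ> ?\<tau>) d (fst (z (?\<tau> k))))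
        = T z d (fst (z (?\<tau> k))) (C z d (fst (z (?\<tau> k))))"
      using T_inv zd \<tau> x unfolding permutation_invariant_def by metis
    then show "s (case e of (z, d) \<Rightarrow> (z \<circ> ?\<tau>, d)) k = s e (?\<tau> k)"
      by (simp add: zd(1) s_def trust_def)
  qed (use \<alpha> in auto)
  have share_meas: "(\<lambda>\<omega>. miscoverage_share \<alpha> n m j (b (W \<omega>)) (s (W \<omega>)) (\<lambda>l. U l \<omega>)) \<in> borel_measurable M"
    if "j \<in> {1..m}" for j
    using \<alpha> that U_meas
    by (intro borel_measurable_miscoverage_share measurable_compose[OF mW b_meas] measurable_compose[OF mW s_meas])
      auto
  let ?f = "\<lambda>\<omega>. \<Sum>j=1..m. miscoverage_share \<alpha> n m j (b (W \<omega>)) (s (W \<omega>)) (\<lambda>l. U l \<omega>)"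
  have "FCR M n m \<alpha> Z D C T U = (\<integral>\<omega>. ?f \<omega> \<partial>M)"
    using \<alpha> m unfolding FCR_def
    by (subst false_coverage_proportion_eq_sum) (simp_all add: W_def b_def s_def N_def)
  \<comment> \<open>Passing to the nonnegative integral makes the sum and the integral
    interchangeable without an integrability proof.\<close>
  also have "\<dots> = enn2real (\<integral>\<^sup>+ \<omega>. ennreal (?f \<omega>) \<partial>M)"
    using share_meas by (intro integral_eq_nn_integral AE_I2 sum_nonneg miscoverage_share_nonneg) auto
  also have "(\<integral>\<^sup>+ \<omega>. ennreal (?f \<omega>) \<partial>M)
      = (\<Sum>j=1..m. \<integral>\<^sup>+ \<omega>. ennreal (miscoverage_share \<alpha> n m j (b (W \<omega>)) (s (W \<omega>)) (\<lambda>l. U l \<omega>)) \<partial>M)"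
    using share_meas by (subst nn_integral_sum[symmetric]) (auto simp: sum_ennreal miscoverage_share_nonneg)
  also have "enn2real \<dots> \<le> \<alpha>"
  proof (rule enn2real_leI)
    have "(\<Sum>j=1..m. \<integral>\<^sup>+ \<omega>. ennreal (miscoverage_share \<alpha> n m j (b (W \<omega>)) (s (W \<omega>)) (\<lambda>l. U l \<omega>)) \<partial>M)
        \<le> (\<Sum>j=1..m. ennreal (\<alpha> / real m))"
      by (intro sum_mono share_le)
    also have "\<dots> = ennreal (\<Sum>j=1..m. \<alpha> / real m)"
      using \<alpha> by (intro sum_ennreal) simp
    also have "(\<Sum>j=1..m. \<alpha> / real m) = \<alpha>" using m by simp
    finally show "(\<Sum>j=1..m. \<integral>\<^sup>+ \<omega>. ennreal (miscoverage_share \<alpha> n m j (b (W \<omega>)) (s (W \<omega>)) (\<lambda>l. U l \<omega>)) \<partial>M)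
        \<le> ennreal \<alpha>" .
  qed (use \<alpha> in simp)
  finally show ?thesis .
qed

end
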